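(* There is an absolute constant $C>0$ such that the following holds. Let $G$ be a strongly regular graph with parameters $(n,k,\lambda,\mu)$, $k\le (n-1)/2$, and adjacency eigenvalues $k\ge r>s$, satisfying the claw bound \[ r \le \max\left\{2(-s-1)(\mu+1+s)+s,\ \frac{s(s+1)(\mu+1)}{2}-1\right\}. \] Then $r/n \le C\, g(n,k)$, where \[ g(n,k) = \min\left\{\left(\frac{k}{n}\right)^{4/3},\ \frac{k^{1/2}}{n^{3/4}},\ \max\left\{\left(\frac{k}{n}\right)^{3/2},\ \left(\frac{1}{n}\right)^{1/2}\right\}\right\}. \]
   Context: A strongly regular graph with parameters $(n,k,\lambda,\mu)$ is a $k$-regular graph on $n$ vertices in which any two adjacent vertices have exactly $\lambda$ common neighbors and any two distinct nonadjacent vertices have exactly $\mu$ common neighbors. Its adjacency eigenvalues are $k$ and two other (restricted) eigenvalues $r>s$, with $k\ge r$. *)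

theory Defs
  imports Complex_Main "Jordan_Normal_Form.Char_Poly"
begin

definition simple_graph :: "nat \<Rightarrow> (nat \<Rightarrow> nat \<Rightarrow> bool) \<Rightarrow> bool" where
  "simple_graph n E \<longleftrightarrow>
     (\<forall>i<n. \<not> E i i) \<and> (\<forall>i<n. \<forall>j<n. E i j \<longleftrightarrow> E j i)"

definition nbrs :: "nat \<Rightarrow> (nat \<Rightarrow> nat \<Rightarrow> bool) \<Rightarrow> nat \<Rightarrow> nat set" where
  "nbrs n E i = {j. j < n \<and> E i j}"

definition strongly_regular ::
  "nat \<Rightarrow> (nat \<Rightarrow> nat \<Rightarrow> bool) \<Rightarrow> nat \<Rightarrow> nat \<Rightarrow> nat \<Rightarrow> bool" where
  "strongly_regular n E k lam mu \<longleftrightarrow>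
     simple_graph n E \<and>
     (\<forall>i<n. card (nbrs n E i) = k) \<and>
     (\<forall>i<n. \<forall>j<n. i \<noteq> j \<longrightarrow> E i j \<longrightarrow> card (nbrs n E i \<inter> nbrs n E j) = lam) \<and>
     (\<forall>i<n. \<forall>j<n. i \<noteq> j \<longrightarrow> \<not> E i j \<longrightarrow> card (nbrs n E i \<inter> nbrs n E j) = mu)"

definition adj_matrix :: "nat \<Rightarrow> (nat \<Rightarrow> nat \<Rightarrow> bool) \<Rightarrow> real mat" where
  "adj_matrix n E = mat n n (\<lambda>(i,j). if E i j then 1 else 0)"

definition g_fun :: "nat \<Rightarrow> nat \<Rightarrow> real" where
  "g_fun n k = min ((real k / real n) powr (4/3))
                  (min (real k powr (1/2) / real n powr (3/4))
                       (max ((real k / real n) powr (3/2)) ((1 / real n) powr (1/2))))"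

end

theory Submission
  imports Defs "HOL-Analysis.Convex"
begin

text \<open>
  Put \<open>t = - s\<close>. The claw bound and \<open>r > 0\<close> force \<open>t > 1\<close>, and \<open>r t = k - \<mu>\<close>,
  \<open>n \<mu> = (k - r) (k + t)\<close>, hence \<open>\<mu> \<ge> 1\<close> and \<open>n \<mu> \<le> 3 k\<^sup>2\<close>.

  \<^item> The claw bound gives \<open>r \<le> 4 t\<^sup>2 \<mu>\<close>, so \<open>r\<^sup>3 \<le> 4 (r t)\<^sup>2 \<mu> \<le> 12 k\<^sup>4 / n\<close>.
  \<^item> The absolute bound says that the \<open>s\<close>-eigenspace has dimension at most the square of the
    dimension of the \<open>r\<close>-eigenspace; this gives \<open>r\<^sup>2 \<le> n t\<^sup>2\<close>, so \<open>r\<^sup>4 \<le> n k\<^sup>2\<close>.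
  \<^item> If \<open>n r\<^sup>2\<close> is large compared with \<open>k\<^sup>3\<close>, then \<open>r\<close> is large compared with \<open>t \<mu>\<close>, and
    most of each neighbourhood is covered by \<open>O(t)\<close> cliques of size close to \<open>\<lambda>\<close>. Cliques at two
    nonadjacent vertices meet in at most one point, so \<open>\<mu> = O(t\<^sup>2)\<close>, whence \<open>r\<^sup>2 = O(n)\<close>.
\<close>

section \<open>The adjacency algebra\<close>

locale srg =
  fixes n :: nat and E :: "nat \<Rightarrow> nat \<Rightarrow> bool" and k lam mu :: nat
  assumes srg: "strongly_regular n E k lam mu"
begin

abbreviation N :: "nat \<Rightarrow> nat set" where "N \<equiv> nbrs n E"

lemma adj_irrefl: "i < n \<Longrightarrow> \<not> E i i"
  and adj_sym: "i < n \<Longrightarrow> j < n \<Longrightarrow> E i j \<longleftrightarrow> E j i"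
  and card_N: "i < n \<Longrightarrow> card (N i) = k"
  and card_N_adj: "i < n \<Longrightarrow> j < n \<Longrightarrow> i \<noteq> j \<Longrightarrow> E i j \<Longrightarrow> card (N i \<inter> N j) = lam"
  and card_N_nonadj: "i < n \<Longrightarrow> j < n \<Longrightarrow> i \<noteq> j \<Longrightarrow> \<not> E i j \<Longrightarrow> card (N i \<inter> N j) = mu"
  using srg unfolding strongly_regular_def simple_graph_def by blast+

lemma finite_N [simp]: "finite (N i)"
  by (simp add: nbrs_def)

lemma mem_N [simp]: "j \<in> N i \<longleftrightarrow> j < n \<and> E i j"
  by (simp add: nbrs_def)

definition adj :: "nat \<Rightarrow> nat \<Rightarrow> real" where
  "adj i j = of_bool (E i j)"

lemma sum_adj: "i < n \<Longrightarrow> (\<Sum>j<n. adj i j) = real k"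
proof -
  assume i: "i < n"
  have "(\<Sum>j<n. adj i j) = (\<Sum>j\<in>N i. 1)"
    by (rule sum.mono_neutral_cong_right) (auto simp: adj_def)
  then show ?thesis using card_N[OF i] by simp
qed

lemma adj_commute: "i < n \<Longrightarrow> j < n \<Longrightarrow> adj i j = adj j i"
  by (simp add: adj_def adj_sym)

lemma sum_adj_left: "j < n \<Longrightarrow> (\<Sum>i<n. adj i j) = real k"
  using sum_adj[of j] sum.cong[OF refl, of "{..<n}" "\<lambda>i. adj i j" "adj j"]
  by (simp add: adj_commute)

text \<open>The \<open>(i, j)\<close> entry of the squared adjacency matrix counts common
  neighbours; the right-hand side merges the equal, adjacent and nonadjacent cases.\<close>

lemma adj_square:
  assumes "i < n" "j < n"
  shows "(\<Sum>l<n. adj i l * adj l j)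
    = (real k - mu) * of_bool (i = j) + (real lam - mu) * adj i j + mu"
proof -
  have "(\<Sum>l<n. adj i l * adj l j) = (\<Sum>l\<in>N i \<inter> N j. 1)"
    by (rule sum.mono_neutral_cong_right) (use assms adj_sym in \<open>auto simp: adj_def\<close>)
  also have "\<dots> = real (card (N i \<inter> N j))" by simp
  also have "\<dots> = (real k - mu) * of_bool (i = j) + (real lam - mu) * adj i j + mu"
    using assms adj_irrefl card_N card_N_adj card_N_nonadj by (auto simp: adj_def)
  finally show ?thesis .
qed

text \<open>An element \<open>p I + q A + w J\<close> of the adjacency algebra.\<close>

definition amat :: "real \<Rightarrow> real \<Rightarrow> real \<Rightarrow> nat \<Rightarrow> nat \<Rightarrow> real" where
  "amat p q w i j = p * of_bool (i = j) + q * adj i j + w"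

text \<open>The span of \<open>I\<close>, \<open>A\<close> and \<open>J\<close> is closed under
  products because \<open>A\<close> squared lies in it and \<open>A J = J A = k J\<close>.\<close>

lemma amat_mult:
  fixes p q w p' q' w' :: real
  assumes "i < n" "j < n"
  shows "(\<Sum>l<n. amat p q w i l * amat p' q' w' l j)
    = amat (p * p' + q * q' * (real k - mu)) (p * q' + q * p' + q * q' * (real lam - mu))
        (p * w' + w * p' + q * q' * mu + (q * w' + w * q') * k + n * w * w') i j"
proof -
  have d1: "(\<Sum>l<n. of_bool (i = l) * f l) = f i" for f :: "nat \<Rightarrow> real"
    using assms by (simp add: of_bool_def if_distrib[of "\<lambda>x. x * _"] cong: if_cong)
  have d2: "(\<Sum>l<n. f l * of_bool (l = j)) = f j" for f :: "nat \<Rightarrow> real"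
    using assms by (simp add: of_bool_def if_distrib[of "\<lambda>x. _ * x"] cong: if_cong)
  have "amat p q w i l * amat p' q' w' l j
    = p * (of_bool (i = l) * amat p' q' w' l j) + p' * ((q * adj i l + w) * of_bool (l = j))
      + q * q' * (adj i l * adj l j) + q * w' * adj i l + w * q' * adj l j + w * w'" for l
    by (auto simp: amat_def algebra_simps)
  then have "(\<Sum>l<n. amat p q w i l * amat p' q' w' l j)
    = p * (\<Sum>l<n. of_bool (i = l) * amat p' q' w' l j)
      + p' * (\<Sum>l<n. (q * adj i l + w) * of_bool (l = j))
      + q * q' * (\<Sum>l<n. adj i l * adj l j) + q * w' * (\<Sum>l<n. adj i l)
      + w * q' * (\<Sum>l<n. adj l j) + n * w * w'"
    by (simp only: sum.distrib sum_distrib_left) (simp add: mult.assoc)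
  also have "\<dots> = p * amat p' q' w' i j + p' * (q * adj i j + w)
      + q * q' * ((real k - mu) * of_bool (i = j) + (real lam - mu) * adj i j + mu)
      + q * w' * k + w * q' * k + n * w * w'"
    using assms by (simp only: d1 d2 sum_adj sum_adj_left adj_square)
  finally show ?thesis by (simp add: amat_def algebra_simps)
qed

lemma amat_commute: "i < n \<Longrightarrow> j < n \<Longrightarrow> amat p q w i j = amat p q w j i"
  by (auto simp: amat_def adj_commute)

text \<open>Both sides count the walks of length two that start at vertex 0.\<close>

lemma k_square:
  assumes "0 < n"
  shows "real k ^ 2 = (real k - mu) + (real lam - mu) * k + real n * mu"
proof -
  have "(\<Sum>j<n. \<Sum>l<n. adj 0 l * adj l j) = (\<Sum>l<n. adj 0 l * (\<Sum>j<n. adj l j))"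
    unfolding sum_distrib_left by (rule sum.swap)
  also have "\<dots> = (\<Sum>l<n. adj 0 l) * k"
    by (simp add: sum_adj sum_distrib_right)
  also have "\<dots> = real k ^ 2" by (simp add: sum_adj assms power2_eq_square)
  finally have "real k ^ 2 = (\<Sum>j<n. (real k - mu) * of_bool (0 = j) + (real lam - mu) * adj 0 j + mu)"
    using assms by (simp add: adj_square)
  also have "\<dots> = (real k - mu) * (\<Sum>j<n. of_bool (0 = j)) + (real lam - mu) * (\<Sum>j<n. adj 0 j) + n * mu"
    by (simp add: sum.distrib sum_distrib_left)
  also have "(\<Sum>j<n. of_bool (0 = j)) = (1::real)"
    using assms by (simp add: of_bool_def)
  finally show ?thesis using assms by (simp add: sum_adj)
qed

section \<open>Eigenvalues and eigenvectors of the adjacency matrix\<close>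

definition eigvec :: "real \<Rightarrow> (nat \<Rightarrow> real) \<Rightarrow> bool" where
  "eigvec x v \<longleftrightarrow> (\<forall>i<n. (\<Sum>j<n. adj i j * v j) = x * v i)"

lemma eigenvalue_iff: "eigenvalue (adj_matrix n E) x \<longleftrightarrow> (\<exists>v. eigvec x v \<and> (\<exists>i<n. v i \<noteq> 0))"
proof
  assume "eigenvalue (adj_matrix n E) x"
  then obtain v where v: "v \<in> carrier_vec n" "v \<noteq> 0\<^sub>v n" "adj_matrix n E *\<^sub>v v = x \<cdot>\<^sub>v v"
    unfolding eigenvalue_def eigenvector_def by (auto simp: adj_matrix_def)
  have "(\<Sum>j<n. adj i j * v $ j) = x * v $ i" if "i < n" for i
  proof -
    have "(adj_matrix n E *\<^sub>v v) $ i = x * v $ i" using v that by simp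
    moreover have "(adj_matrix n E *\<^sub>v v) $ i = (\<Sum>j<n. adj i j * v $ j)"
      using carrier_vecD[OF v(1)] that by (simp add: adj_matrix_def scalar_prod_def adj_def lessThan_atLeast0 of_bool_def if_distrib[of "\<lambda>x. x * _"] cong: if_cong)
    ultimately show ?thesis by simp
  qed
  moreover have "\<exists>i<n. v $ i \<noteq> 0"
    using v by (metis carrier_vecD eq_vecI index_zero_vec)
  ultimately show "\<exists>v. eigvec x v \<and> (\<exists>i<n. v i \<noteq> 0)"
    unfolding eigvec_def by (intro exI[of _ "\<lambda>i. v $ i"]) auto
next
  assume "\<exists>v. eigvec x v \<and> (\<exists>i<n. v i \<noteq> 0)"
  then obtain v i where v: "eigvec x v" "i < n" "v i \<noteq> 0" by auto
  have "adj_matrix n E *\<^sub>v vec n v = x \<cdot>\<^sub>v vec n v"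
  proof (rule eq_vecI)
    fix i assume "i < dim_vec (x \<cdot>\<^sub>v vec n v)"
    then have i: "i < n" by simp
    then have "(adj_matrix n E *\<^sub>v vec n v) $ i = (\<Sum>j<n. adj i j * v j)"
      by (simp add: adj_matrix_def scalar_prod_def adj_def lessThan_atLeast0 of_bool_def if_distrib[of "\<lambda>x. x * _"] cong: if_cong)
    then show "(adj_matrix n E *\<^sub>v vec n v) $ i = (x \<cdot>\<^sub>v vec n v) $ i"
      using i v(1) by (simp add: eigvec_def)
  qed (simp add: adj_matrix_def)
  moreover have "vec n v \<noteq> 0\<^sub>v n"
    using v by (metis index_vec index_zero_vec(1))
  ultimately show "eigenvalue (adj_matrix n E) x"
    unfolding eigenvalue_def eigenvector_def
    by (intro exI[of _ "vec n v"]) (auto simp: adj_matrix_def)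
qed

text \<open>Summing the eigenvector equation over all coordinates and using the constant column sum
  \<open>k\<close> leaves \<open>x - k\<close> times the coordinate sum equal to zero.\<close>

lemma eigvec_sum_zero:
  assumes "eigvec x v" "x \<noteq> k"
  shows "(\<Sum>i<n. v i) = 0"
proof -
  have "x * (\<Sum>i<n. v i) = (\<Sum>i<n. \<Sum>j<n. adj i j * v j)"
    using assms(1) by (simp add: eigvec_def sum_distrib_left)
  also have "\<dots> = (\<Sum>j<n. \<Sum>i<n. adj i j * v j)" by (rule sum.swap)
  also have "\<dots> = (\<Sum>j<n. (\<Sum>i<n. adj i j) * v j)" by (simp add: sum_distrib_right)
  also have "\<dots> = k * (\<Sum>i<n. v i)" by (simp add: sum_adj_left sum_distrib_left)
  finally have "(x - k) * (\<Sum>i<n. v i) = 0" by (simp add: algebra_simps)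
  then show ?thesis using assms(2) by simp
qed

lemma adj_adj_apply:
  assumes "(\<Sum>i<n. v i) = 0" "i < n"
  shows "(\<Sum>l<n. adj i l * (\<Sum>j<n. adj l j * v j))
    = (real k - mu) * v i + (real lam - mu) * (\<Sum>j<n. adj i j * v j)"
proof -
  have "(\<Sum>l<n. adj i l * (\<Sum>j<n. adj l j * v j)) = (\<Sum>j<n. (\<Sum>l<n. adj i l * adj l j) * v j)"
    unfolding sum_distrib_left sum_distrib_right mult.assoc by (rule sum.swap)
  also have "\<dots> = (\<Sum>j<n. ((real k - mu) * of_bool (i = j) + (real lam - mu) * adj i j + mu) * v j)"
    using assms by (simp add: adj_square)
  also have "\<dots> = (real k - mu) * (\<Sum>j<n. of_bool (i = j) * v j)
      + (real lam - mu) * (\<Sum>j<n. adj i j * v j) + mu * (\<Sum>j<n. v j)"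
    by (simp only: distrib_right sum.distrib sum_distrib_left mult.assoc)
  also have "(\<Sum>j<n. of_bool (i = j) * v j) = v i"
    using assms by (simp add: of_bool_def if_distrib[of "\<lambda>x. x * _"] cong: if_cong)
  finally show ?thesis using assms by simp
qed

text \<open>The squared adjacency matrix is applied to an eigenvector in two ways; its
  \<open>J\<close> part vanishes there because the coordinates sum to zero.\<close>

lemma restricted_eigenvalue_quadratic:
  assumes "eigenvalue (adj_matrix n E) x" "x \<noteq> k"
  shows "x ^ 2 = (real k - mu) + (real lam - mu) * x"
proof -
  obtain v i where v: "eigvec x v" and i: "i < n" "v i \<noteq> 0"
    using assms(1) eigenvalue_iff by auto
  have "(\<Sum>l<n. adj i l * (\<Sum>j<n. adj l j * v j)) = x * (x * v i)"
    using v i by (simp add: eigvec_def mult.left_commute flip: sum_distrib_left)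
  with adj_adj_apply[OF eigvec_sum_zero[OF v assms(2)] i(1)]
  have "x ^ 2 * v i = ((real k - mu) + (real lam - mu) * x) * v i"
    using v i by (simp add: eigvec_def algebra_simps power2_eq_square)
  then show ?thesis using i by simp
qed

text \<open>If the conjugate root is not an eigenvalue, then \<open>A - sI\<close> kills \<open>e\<^sub>0 - e\<^sub>1\<close>, which forces
  \<open>s = - A\<^sub>0\<^sub>1\<close>.\<close>

lemma conjugate_eigenvalue:
  assumes "s ^ 2 = (real k - mu) + (real lam - mu) * s" "s \<noteq> 0" "s \<noteq> -1" "2 \<le> n"
  shows "eigenvalue (adj_matrix n E) (real lam - mu - s)"
proof -
  define v :: "nat \<Rightarrow> real" where "v i = of_bool (i = 0) - of_bool (i = 1)" for i
  \<comment> \<open>With \<open>s'\<close> the other root of the quadratic,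
    \<open>(A - s' I) (A - s I) = mu J\<close>, which kills \<open>v\<close>. So
    \<open>u = (A - s I) v\<close> is an \<open>s'\<close>-eigenvector once it is nonzero.\<close>
  define u where "u i = (\<Sum>j<n. adj i j * v j) - s * v i" for i
  have delta: "(\<Sum>j<n. f j * of_bool (j = m)) = f m" if "m < n" for f :: "nat \<Rightarrow> real" and m
    using that by (simp add: of_bool_def if_distrib[of "\<lambda>x. _ * x"] cong: if_cong)
  have v0: "(\<Sum>i<n. v i) = 0"
    using assms(4) delta[of 0 "\<lambda>_. 1"] delta[of 1 "\<lambda>_. 1"] by (simp add: v_def sum_subtractf)
  have "(\<Sum>j<n. adj i j * u j) = (real lam - mu - s) * u i" if i: "i < n" for i
  proof -
    have "(\<Sum>j<n. adj i j * u j) = (\<Sum>l<n. adj i l * (\<Sum>j<n. adj l j * v j)) - s * (\<Sum>j<n. adj i j * v j)"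
      by (simp add: u_def right_diff_distrib sum_subtractf sum_distrib_left mult.left_commute)
    also have "\<dots> = (real k - mu) * v i + (real lam - mu - s) * (\<Sum>j<n. adj i j * v j)"
      using adj_adj_apply[OF v0 i] by (simp add: algebra_simps)
    also have "real k - mu = s ^ 2 - (real lam - mu) * s" using assms(1) by simp
    finally show ?thesis by (simp add: u_def algebra_simps power2_eq_square)
  qed
  moreover have "u 0 \<noteq> 0"
  proof -
    have "(\<Sum>j<n. adj 0 j * v j) = adj 0 0 - adj 0 1"
      using assms(4) delta[of 0 "adj 0"] delta[of 1 "adj 0"]
      by (simp add: v_def right_diff_distrib sum_subtractf)
    then have "u 0 = - adj 0 1 - s"
      using adj_irrefl[of 0] assms(4) by (simp add: u_def v_def adj_def)
    then show ?thesis using assms(2,3) by (auto simp: adj_def)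
  qed
  ultimately show ?thesis unfolding eigenvalue_iff eigvec_def
    using assms(4) by (intro exI[of _ u]) (auto intro!: exI[of _ 0])
qed

end

section \<open>The absolute bound\<close>

text \<open>Cauchy-Schwarz for the Frobenius product of \<open>W\<close> with the sum
  \<open>T\<close> of the rank-one matrices of the \<open>h z\<close>. As \<open>W\<close> fixes
  every \<open>h z\<close>, this product is the trace of \<open>T\<close>; the Frobenius norm of
  \<open>T\<close> is that of the Gram matrix of the \<open>h z\<close>.\<close>

lemma gram_trace_ineq:
  fixes h :: "'a \<Rightarrow> 'b \<Rightarrow> real"
  assumes W: "\<And>z p. z \<in> Z \<Longrightarrow> p \<in> I \<Longrightarrow> (\<Sum>q\<in>I. W p q * h z q) = h z p"
  shows "(\<Sum>z\<in>Z. \<Sum>p\<in>I. h z p * h z p)\<^sup>2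
    \<le> (\<Sum>z\<in>Z. \<Sum>z'\<in>Z. (\<Sum>p\<in>I. h z p * h z' p)\<^sup>2) * (\<Sum>p\<in>I. \<Sum>q\<in>I. (W p q)\<^sup>2)"
proof -
  define T where "T p q = (\<Sum>z\<in>Z. h z p * h z q)" for p q
  have "(\<Sum>p\<in>I. \<Sum>q\<in>I. T p q * W p q) = (\<Sum>p\<in>I. \<Sum>z\<in>Z. \<Sum>q\<in>I. h z p * (W p q * h z q))"
    unfolding T_def sum_distrib_right
    by (rule sum.cong[OF refl], subst sum.swap) (simp add: mult_ac)
  also have "\<dots> = (\<Sum>p\<in>I. \<Sum>z\<in>Z. h z p * h z p)"
    by (simp add: W flip: sum_distrib_left)
  finally have TW: "(\<Sum>p\<in>I. \<Sum>q\<in>I. T p q * W p q) = (\<Sum>z\<in>Z. \<Sum>p\<in>I. h z p * h z p)"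
    by (simp add: sum.swap[of _ Z])
  have "(\<Sum>p\<in>I. \<Sum>q\<in>I. (T p q)\<^sup>2)
      = (\<Sum>(p,q)\<in>I \<times> I. \<Sum>(z,z')\<in>Z \<times> Z. (h z p * h z' p) * (h z q * h z' q))"
    unfolding T_def power2_eq_square sum_product sum.cartesian_product[symmetric]
    by (simp add: mult_ac)
  also have "\<dots> = (\<Sum>(z,z')\<in>Z \<times> Z. \<Sum>(p,q)\<in>I \<times> I. (h z p * h z' p) * (h z q * h z' q))"
    unfolding case_prod_unfold by (rule sum.swap)
  also have "\<dots> = (\<Sum>z\<in>Z. \<Sum>z'\<in>Z. (\<Sum>p\<in>I. h z p * h z' p)\<^sup>2)"
    unfolding power2_eq_square sum_product sum.cartesian_product[symmetric] ..
  finally have TT: "(\<Sum>p\<in>I. \<Sum>q\<in>I. (T p q)\<^sup>2) = (\<Sum>z\<in>Z. \<Sum>z'\<in>Z. (\<Sum>p\<in>I. h z p * h z' p)\<^sup>2)" .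
  have "(\<Sum>(p,q)\<in>I \<times> I. T p q * W p q)\<^sup>2 \<le> (\<Sum>(p,q)\<in>I \<times> I. (T p q)\<^sup>2) * (\<Sum>(p,q)\<in>I \<times> I. (W p q)\<^sup>2)"
    unfolding case_prod_unfold by (rule Cauchy_Schwarz_ineq_sum)
  then show ?thesis
    by (simp only: TW TT flip: sum.cartesian_product)
qed

text \<open>Here \<open>P\<close> and \<open>S\<close> are orthogonal projections and the image of \<open>S\<close> is an eigenspace of the
  Schur square of \<open>P\<close>. Mapping \<open>e\<^sub>x\<close> to the square of the \<open>x\<close>-th row of \<open>P\<close> embeds that
  image into the range of \<open>P \<otimes> P\<close>; comparing dimensions (as traces) gives the bound.\<close>

lemma schur_square_dimension_bound:
  fixes P S :: "nat \<Rightarrow> nat \<Rightarrow> real"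
  assumes P_sym: "\<And>i j. i < n \<Longrightarrow> j < n \<Longrightarrow> P i j = P j i"
    and P_idem: "\<And>i j. i < n \<Longrightarrow> j < n \<Longrightarrow> (\<Sum>l<n. P i l * P l j) = P i j"
    and S_sym: "\<And>i j. i < n \<Longrightarrow> j < n \<Longrightarrow> S i j = S j i"
    and S_idem: "\<And>i j. i < n \<Longrightarrow> j < n \<Longrightarrow> (\<Sum>l<n. S i l * S l j) = S i j"
    and PPS: "\<And>i j. i < n \<Longrightarrow> j < n \<Longrightarrow> (\<Sum>l<n. (P i l)\<^sup>2 * S l j) = \<theta> * S i j"
    and \<theta>: "\<theta> \<noteq> 0"
  shows "(\<Sum>i<n. S i i) \<le> (\<Sum>i<n. P i i)\<^sup>2"
proof -
  let ?I = "{..<n} \<times> {..<n}"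
  define h where "h z p = (\<Sum>x<n. S z x * (P x (fst p) * P x (snd p)))" for z p
  \<comment> \<open>\<open>W\<close> is the tensor square of \<open>P\<close>, and
    \<open>h z\<close> is the image of row \<open>z\<close> of \<open>S\<close> under the
    embedding.\<close>
  define W where "W p q = P (fst p) (fst q) * P (snd p) (snd q)" for p q
  have PP: "(\<Sum>l<n. P i l * P j l) = P i j" if "i < n" "j < n" for i j
    using P_idem[OF that] P_sym that by simp
  have SS: "(\<Sum>l<n. S i l * S j l) = S i j" if "i < n" "j < n" for i j
    using S_idem[OF that] S_sym that by simp
  have rows: "(\<Sum>p\<in>?I. (P i (fst p) * P j (fst p)) * (P i' (snd p) * P j' (snd p))) = P i j * P i' j'"
    if "i < n" "j < n" "i' < n" "j' < n" for i j i' j'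
  proof -
    have "P i j * P i' j' = (\<Sum>l<n. P i l * P j l) * (\<Sum>l<n. P i' l * P j' l)"
      using that by (simp add: PP)
    then show ?thesis by (simp add: sum_product sum.cartesian_product case_prod_unfold)
  qed
  have Wh: "(\<Sum>q\<in>?I. W p q * h z q) = h z p" if "z \<in> {..<n}" "p \<in> ?I" for z p
  proof -
    have "(\<Sum>q\<in>?I. W p q * h z q) = (\<Sum>x<n. S z x *
        (\<Sum>q\<in>?I. (P (fst p) (fst q) * P x (fst q)) * (P (snd p) (snd q) * P x (snd q))))"
      unfolding W_def h_def sum_distrib_left by (subst sum.swap) (simp add: mult_ac)
    also have "\<dots> = h z p"
      unfolding h_def using that by (intro sum.cong) (auto simp: rows P_sym)
    finally show ?thesis .
  qed
  \<comment> \<open>The Gram matrix is \<open>S\<close> times the Schur square of \<open>P\<close>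
    times \<open>S\<close>, which collapses by \<open>PPS\<close> and idempotence.\<close>
  have gram: "(\<Sum>p\<in>?I. h z p * h z' p) = \<theta> * S z z'" if z: "z < n" "z' < n" for z z'
  proof -
    have "(\<Sum>p\<in>?I. h z p * h z' p) = (\<Sum>p\<in>?I. \<Sum>q\<in>?I. S z (fst q) * S z' (snd q) *
        ((P (fst q) (fst p) * P (snd q) (fst p)) * (P (fst q) (snd p) * P (snd q) (snd p))))"
      unfolding h_def sum_product sum.cartesian_product by (simp add: case_prod_unfold mult_ac)
    also have "\<dots> = (\<Sum>x<n. \<Sum>y<n. S z x * S z' y *
          (\<Sum>p\<in>?I. (P x (fst p) * P y (fst p)) * (P x (snd p) * P y (snd p))))"
      unfolding sum_distrib_left
      by (subst sum.swap) (simp only: sum.cartesian_product[symmetric] sum.cartesian_product' fst_conv snd_conv)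
    also have "\<dots> = (\<Sum>x<n. \<Sum>y<n. S z x * S z' y * (P x y * P x y))"
      by (simp add: rows)
    also have "\<dots> = (\<Sum>x<n. S z x * (\<Sum>y<n. (P x y)\<^sup>2 * S y z'))"
      using z by (simp add: power2_eq_square S_sym[of z'] mult_ac sum_distrib_left)
    also have "\<dots> = \<theta> * (\<Sum>x<n. S z x * S x z')"
      using z by (simp add: PPS sum_distrib_left mult.left_commute)
    finally show ?thesis using z by (simp add: S_idem)
  qed
  define g f where "g = (\<Sum>i<n. S i i)" and "f = (\<Sum>i<n. P i i)"
  have "(\<Sum>p\<in>?I. \<Sum>q\<in>?I. (W p q)\<^sup>2) = (\<Sum>p\<in>?I. P (fst p) (fst p) * P (snd p) (snd p))"
  proof (rule sum.cong[OF refl])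
    fix p assume p: "p \<in> ?I"
    have "(\<Sum>q\<in>?I. (W p q)\<^sup>2) = (\<Sum>q\<in>?I. (P (fst p) (fst q) * P (fst p) (fst q)) * (P (snd p) (snd q) * P (snd p) (snd q)))"
      by (simp add: W_def power2_eq_square mult_ac)
    also have "\<dots> = P (fst p) (fst p) * P (snd p) (snd p)"
      using p by (intro rows) auto
    finally show "(\<Sum>q\<in>?I. (W p q)\<^sup>2) = P (fst p) (fst p) * P (snd p) (snd p)" .
  qed
  also have "\<dots> = f\<^sup>2"
    by (simp add: f_def power2_eq_square sum_product sum.cartesian_product case_prod_unfold)
  finally have WW: "(\<Sum>p\<in>?I. \<Sum>q\<in>?I. (W p q)\<^sup>2) = f\<^sup>2" .
  have "(\<Sum>z<n. \<Sum>z'<n. (\<Sum>p\<in>?I. h z p * h z' p)\<^sup>2) = \<theta>\<^sup>2 * (\<Sum>z<n. \<Sum>z'<n. S z z' * S z z')"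
    by (simp add: gram sum_distrib_left power2_eq_square mult_ac)
  also have "\<dots> = \<theta>\<^sup>2 * g"
    by (simp add: SS g_def)
  finally have GG: "(\<Sum>z<n. \<Sum>z'<n. (\<Sum>p\<in>?I. h z p * h z' p)\<^sup>2) = \<theta>\<^sup>2 * g" .
  have G: "(\<Sum>z<n. \<Sum>p\<in>?I. h z p * h z p) = \<theta> * g"
    by (simp add: gram g_def sum_distrib_left)
  have "(\<theta> * g)\<^sup>2 \<le> \<theta>\<^sup>2 * g * f\<^sup>2"
    using gram_trace_ineq[of "{..<n}" ?I W h, OF Wh] unfolding G GG WW by simp
  then have "\<theta>\<^sup>2 * (g * g) \<le> \<theta>\<^sup>2 * (g * f\<^sup>2)"
    by (simp add: power2_eq_square mult_ac)
  then have "g * g \<le> g * f\<^sup>2"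
    using \<theta> by (simp add: mult_le_cancel_left)
  \<comment> \<open>Each diagonal entry of \<open>S\<close> is the sum of squares of its
    row.\<close>
  moreover have "0 \<le> g"
    unfolding g_def using SS by (intro sum_nonneg) (metis lessThan_iff sum_nonneg zero_le_square)
  ultimately have "g \<le> f\<^sup>2" by (cases "g = 0") auto
  then show ?thesis by (simp add: g_def f_def)
qed

section \<open>The absolute bound for strongly regular graphs\<close>

context srg
begin

text \<open>The algebra is also closed under Schur squares: \<open>of_bool (i = j)\<close> and
  \<open>adj i j\<close> take values 0 and 1 and are never both 1.\<close>

lemma amat_entry_square:
  fixes p q w :: real
  shows
  "i < n \<Longrightarrow> j < n \<Longrightarrow> (amat p q w i j)\<^sup>2 = amat (p\<^sup>2 + 2 * p * w) (q\<^sup>2 + 2 * q * w) (w\<^sup>2) i j"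
  using adj_irrefl[of i] by (auto simp: amat_def adj_def power2_sum)

lemma sum_amat_diag:
  fixes p q w :: real
  shows "(\<Sum>i<n. amat p q w i i) = n * (p + w)"
  using adj_irrefl by (simp add: amat_def adj_def)

text \<open>The \<open>r\<close>-eigenspace has dimension about \<open>- n s / (r - s)\<close>, the \<open>s\<close>-eigenspace about
  \<open>n r / (r - s)\<close>.\<close>

lemma r_square_le:
  fixes r s :: real
  assumes sum: "r + s = real lam - mu" and prod: "r * s = real mu - k"
    and r: "0 < r" "r \<le> k" and s: "s < -1" and k: "k < n"
  shows "r\<^sup>2 \<le> n * s\<^sup>2"
proof -
  have n: "0 < n" using k by simp
  define K M L m where "K = real k" and "M = real mu" and "L = real lam" and "m = real n"
  note folds = K_def[symmetric] M_def[symmetric] L_def[symmetric] m_def[symmetric]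
  note mult = amat_mult[unfolded folds] and sum = sum[unfolded folds] and prod = prod[unfolded folds]
  have m: "0 < m" using n by (simp add: m_def)
  have nmu: "m * M = (K - r) * (K - s)"
    using k_square[OF n, unfolded folds] sum prod by Groebner_Basis.algebra
  define c x y where "c = 1 / (r - s)" and "x = (K - s) / m" and "y = (K - r) / m"
  have c: "c * (r - s) = 1" and x: "m * x = K - s" and y: "m * y = K - r"
    using r s m by (simp_all add: c_def x_def y_def)
  have mu: "M = m * x * y"
  proof -
    have "m * M = m * (m * x * y)" using nmu x y by Groebner_Basis.algebra
    then show ?thesis using m by simp
  qed
  \<comment> \<open>\<open>P = (A - s I - x J) / (r - s)\<close> and
    \<open>S = (r I - A + y J) / (r - s)\<close>. The \<open>J\<close> terms make both vanish on
    constant vectors, so these are the projections onto the restricted \<open>r\<close>- and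
    \<open>s\<close>-eigenspaces.\<close>
  define P S where "P = amat (- s * c) c (- x * c)" and "S = amat (r * c) (- c) (y * c)"
  have cc: "c * c * (r - s) = c" using c by Groebner_Basis.algebra
  have P_idem: "(\<Sum>l<n. P i l * P l j) = P i j" if "i < n" "j < n" for i j
  proof -
    have 1: "- s * c * (- s * c) + c * c * (K - M) = - s * c"
      using prod cc by Groebner_Basis.algebra
    have 2: "- s * c * c + c * (- s * c) + c * c * (L - M) = c"
      using sum cc by Groebner_Basis.algebra
    have 3: "- s * c * (- x * c) + - x * c * (- s * c) + c * c * M
        + (c * (- x * c) + - x * c * c) * K + m * (- x * c) * (- x * c) = - x * c"
      using mu x y cc by Groebner_Basis.algebra
    show ?thesis unfolding P_def mult[OF that] 1 2 3 ..
  qed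
  have S_idem: "(\<Sum>l<n. S i l * S l j) = S i j" if "i < n" "j < n" for i j
  proof -
    have 1: "r * c * (r * c) + - c * - c * (K - M) = r * c"
      using prod cc by Groebner_Basis.algebra
    have 2: "r * c * - c + - c * (r * c) + - c * - c * (L - M) = - c"
      using sum cc by Groebner_Basis.algebra
    have 3: "r * c * (y * c) + y * c * (r * c) + - c * - c * M
        + (- c * (y * c) + y * c * - c) * K + m * (y * c) * (y * c) = y * c"
      using mu x y cc by Groebner_Basis.algebra
    show ?thesis unfolding S_def mult[OF that] 1 2 3 ..
  qed
  \<comment> \<open>The value \<open>p + q s\<close> taken by the Schur square of \<open>P\<close>
    on the \<open>s\<close>-eigenspace, for the \<open>p\<close> and \<open>q\<close> below; it is
    nonzero because \<open>s < -1\<close>.\<close>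
  define \<theta> where "\<theta> = c * c * s * (s + 1)"
  have PPS: "(\<Sum>l<n. (P i l)\<^sup>2 * S l j) = \<theta> * S i j" if ij: "i < n" "j < n" for i j
  proof -
    define p q w where "p = (- s * c)\<^sup>2 + 2 * (- s * c) * (- x * c)"
      and "q = c\<^sup>2 + 2 * c * (- x * c)" and "w = (- x * c)\<^sup>2"
    have 1: "p * (r * c) + q * - c * (K - M) = \<theta> * (r * c)"
      using prod unfolding p_def q_def \<theta>_def by Groebner_Basis.algebra
    have 2: "p * - c + q * (r * c) + q * - c * (L - M) = \<theta> * - c"
      using sum unfolding p_def q_def \<theta>_def by Groebner_Basis.algebra
    have 3: "p * (y * c) + w * (r * c) + q * - c * M
        + (q * (y * c) + w * - c) * K + m * w * (y * c) = \<theta> * (y * c)"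
      using mu x y unfolding p_def q_def w_def \<theta>_def by Groebner_Basis.algebra
    have "(\<Sum>l<n. (P i l)\<^sup>2 * S l j) = (\<Sum>l<n. amat p q w i l * S l j)"
      using ij by (simp add: P_def p_def q_def w_def amat_entry_square)
    also have "\<dots> = \<theta> * S i j"
      unfolding S_def mult[OF ij] 1 2 3 by (simp add: amat_def algebra_simps)
    finally show ?thesis .
  qed
  have "c > 0" using r s by (simp add: c_def)
  then have "\<theta> \<noteq> 0" using s by (simp add: \<theta>_def)
  then have "(\<Sum>i<n. S i i) \<le> (\<Sum>i<n. P i i)\<^sup>2"
    using P_idem S_idem PPS
    by (intro schur_square_dimension_bound[of n P S \<theta>]) (auto simp: P_def S_def amat_commute)
  then have *: "m * (r * c + y * c) \<le> (m * (- s * c + - x * c))\<^sup>2"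
    by (simp add: P_def S_def sum_amat_diag m_def)
  have "m * (r * c + y * c) = c * (m * r + (K - r))" using y by Groebner_Basis.algebra
  moreover have "(m * (- s * c + - x * c))\<^sup>2 = c\<^sup>2 * (m * s + (K - s))\<^sup>2" using x by Groebner_Basis.algebra
  ultimately have "c * (m * r + (K - r)) \<le> c\<^sup>2 * (m * s + (K - s))\<^sup>2" using * by simp
  then have "(r - s)\<^sup>2 * (c * (m * r + (K - r))) \<le> (r - s)\<^sup>2 * (c\<^sup>2 * (m * s + (K - s))\<^sup>2)"
    by (rule mult_left_mono) simp
  moreover have "(r - s)\<^sup>2 * (c * (m * r + (K - r))) = (r - s) * (m * r + (K - r))" using c by Groebner_Basis.algebra
  moreover have "(r - s)\<^sup>2 * (c\<^sup>2 * (m * s + (K - s))\<^sup>2) = (m * s + (K - s))\<^sup>2" using c by Groebner_Basis.algebra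
  ultimately have "(r - s) * (m * r + (K - r)) \<le> (m * s + (K - s))\<^sup>2" by simp
  moreover have "r * (m * r) \<le> (r - s) * (m * r + (K - r))"
    using r s m by (intro mult_mono) (auto simp: K_def)
  \<comment> \<open>\<open>m * s\<close> is negative and the positive correction
    \<open>K - s\<close> is at most twice its absolute value, so adding it cannot increase the
    absolute value.\<close>
  moreover have "(m * s + (K - s))\<^sup>2 \<le> (m * s)\<^sup>2"
  proof -
    have "m * 1 \<le> m * - s" using s m by (intro mult_left_mono) auto
    moreover have "1 * - s \<le> m * - s" using s n by (intro mult_right_mono) (auto simp: m_def)
    moreover have "0 \<le> K" "K \<le> m" using k by (auto simp: K_def m_def)
    ultimately have "\<bar>m * s + (K - s)\<bar> \<le> \<bar>m * s\<bar>" using s by linarith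
    then show ?thesis by (simp add: abs_le_square_iff)
  qed
  ultimately have "m * (r\<^sup>2) \<le> m * (m * s\<^sup>2)" by (simp add: power2_eq_square mult_ac)
  then show ?thesis using m by (simp add: m_def)
qed

end

section \<open>Local clique geometry\<close>

text \<open>Adding the sets one by one, each new set loses at most \<open>b\<close> points to every
  earlier one. The square is a generous bound for the number of pairs.\<close>

lemma card_UN_overlap_bound:
  assumes "finite I" "\<And>i. i \<in> I \<Longrightarrow> finite (A i)" "\<And>i. i \<in> I \<Longrightarrow> a \<le> card (A i)"
    and "\<And>i j. i \<in> I \<Longrightarrow> j \<in> I \<Longrightarrow> i \<noteq> j \<Longrightarrow> card (A i \<inter> A j) \<le> b"
  shows "card I * a \<le> card (\<Union>i\<in>I. A i) + (card I)\<^sup>2 * b"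
  using assms
proof (induction I rule: finite_induct)
  case (insert i I)
  let ?U = "\<Union>j\<in>I. A j"
  have IH: "card I * a \<le> card ?U + (card I)\<^sup>2 * b"
    using insert.prems by (intro insert.IH) auto
  have "card (A i \<inter> ?U) = card (\<Union>j\<in>I. A i \<inter> A j)" by (simp only: Int_UN_distrib)
  also have "\<dots> \<le> (\<Sum>j\<in>I. card (A i \<inter> A j))" using insert.hyps by (intro card_UN_le)
  also have "\<dots> \<le> (\<Sum>j\<in>I. b)"
    using insert.prems insert.hyps by (intro sum_mono) auto
  finally have "card (A i \<inter> ?U) \<le> card I * b" by simp
  moreover have "card (A i) + card ?U = card (A i \<union> ?U) + card (A i \<inter> ?U)"
    using insert.prems insert.hyps by (intro card_Un_Int) auto
  moreover have "a \<le> card (A i)" using insert.prems by simp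
  ultimately show ?case using IH insert.hyps
    by (simp add: power2_eq_square algebra_simps)
qed simp

context srg
begin

text \<open>Such a set together with \<open>x\<close> is a claw centred at \<open>x\<close>.\<close>

definition indep :: "nat \<Rightarrow> nat set \<Rightarrow> bool" where
  "indep x I \<longleftrightarrow> I \<subseteq> N x \<and> (\<forall>y\<in>I. \<forall>z\<in>I. \<not> E y z)"

text \<open>For \<open>y\<close> in \<open>I\<close>, the vertex \<open>y\<close> and its common
  neighbours with \<open>x\<close> form a set of size \<open>lam + 1\<close> inside
  \<open>N x\<close>. Two of these sets overlap in at most \<open>mu\<close> points, since their
  centres are nonadjacent.\<close>

lemma indep_card_bound:
  assumes x: "x < n" and I: "indep x I"
  shows "card I * (lam + 1) \<le> k + (card I)\<^sup>2 * mu"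
proof -
  have In: "y < n" "E x y" if "y \<in> I" for y using I that by (auto simp: indep_def)
  have fin: "finite I" using I finite_subset[of I "N x"] by (auto simp: indep_def)
  define A where "A y = insert y (N x \<inter> N y)" for y
  have "card I * (lam + 1) \<le> card (\<Union>y\<in>I. A y) + (card I)\<^sup>2 * mu"
  proof (rule card_UN_overlap_bound[OF fin])
    fix y assume y: "y \<in> I"
    show "lam + 1 \<le> card (A y)"
      using card_N_adj[OF x In(1)[OF y] _ In(2)[OF y]] adj_irrefl In[OF y]
      by (auto simp: A_def card_insert_if)
  next
    fix y z assume yz: "y \<in> I" "z \<in> I" "y \<noteq> z"
    then have "A y \<inter> A z \<subseteq> N y \<inter> N z" using I by (auto simp: A_def indep_def)
    then have "card (A y \<inter> A z) \<le> card (N y \<inter> N z)" by (intro card_mono) auto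
    then show "card (A y \<inter> A z) \<le> mu"
      using yz I In card_N_nonadj by (auto simp: indep_def)
  qed (auto simp: A_def)
  moreover have "card (\<Union>y\<in>I. A y) \<le> card (N x)"
    using In by (intro card_mono) (auto simp: A_def)
  ultimately show ?thesis using card_N[OF x] by simp
qed

definition clique :: "nat set \<Rightarrow> bool" where
  "clique K \<longleftrightarrow> (\<forall>y\<in>K. \<forall>z\<in>K. y \<noteq> z \<longrightarrow> E y z)"

text \<open>A maximum independent set \<open>I\<close> of \<open>N x\<close> yields one clique for each \<open>y \<in> I\<close>: the
  vertices of \<open>N x\<close> whose only neighbour in \<open>I\<close> is \<open>y\<close>. Two nonadjacent ones could
  replace \<open>y\<close> in \<open>I\<close>.\<close>

lemma clique_cover:
  assumes x: "x < n" and m: "\<And>I. indep x I \<Longrightarrow> card I \<le> m"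
  obtains F where "finite F" "card F \<le> m" "card (N x - \<Union>F) \<le> m\<^sup>2 * mu"
    "\<And>K. K \<in> F \<Longrightarrow> K \<subseteq> N x \<and> clique K \<and> lam + 1 \<le> card K + m * mu"
proof -
  obtain I where I: "indep x I" and max: "\<And>J. indep x J \<Longrightarrow> card J \<le> card I"
    using ex_has_greatest_nat[of "indep x" "{}" card "Suc m"] m
    by (metis empty_iff empty_subsetI indep_def less_Suc_eq_le)
  have In: "y < n" "E x y" "E y x" if "y \<in> I" for y
    using I that adj_sym x by (auto simp: indep_def)
  have fin: "finite I" using I finite_subset[of I "N x"] by (auto simp: indep_def)
  have non: "\<not> E y z" if "y \<in> I" "z \<in> I" for y z using I that by (auto simp: indep_def)
  have Im: "card I \<le> m" using m I by simp
  have common: "card (N y \<inter> N z) = mu" if "y \<in> I" "z \<in> I" "y \<noteq> z" for y z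
    using that In non by (intro card_N_nonadj) auto
  define K where "K y = {z \<in> N x. z = y \<or> E y z \<and> (\<forall>y'\<in>I. y' \<noteq> y \<longrightarrow> \<not> E y' z)}" for y
  have cl: "clique (K y)" if y: "y \<in> I" for y
    unfolding clique_def
  proof (intro ballI impI)
    fix u v assume uv: "u \<in> K y" "v \<in> K y" "u \<noteq> v"
    show "E u v"
    proof (cases "u = y \<or> v = y")
      case True
      then show ?thesis using uv In[OF y] by (auto simp: K_def adj_sym)
    next
      case False
      show ?thesis
      proof (rule ccontr)
        assume nuv: "\<not> E u v"
        have uvn: "u < n" "v < n" "E x u" "E x v" "E y u" "E y v"
          using uv False by (auto simp: K_def)
        have 1: "\<not> E y' u" "\<not> E y' v" "\<not> E u y'" "\<not> E v y'" if "y' \<in> I - {y}" for y'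
          using that uv False uvn In adj_sym by (auto simp: K_def)
        have 2: "\<not> E v u" "\<not> E u u" "\<not> E v v" using nuv uvn adj_sym adj_irrefl by auto
        have "indep x (insert u (insert v (I - {y})))"
          using 1 2 nuv uvn non In by (auto simp: indep_def)
        then have "card (insert u (insert v (I - {y}))) \<le> card I" by (rule max)
        moreover have "u \<notin> I" "v \<notin> I" using non[OF y] uvn by auto
        moreover have "0 < card I" using y fin by (auto simp: card_gt_0_iff)
        ultimately show False using fin uv(3) y by (simp add: card_insert_if)
      qed
    qed
  qed
  have sz: "lam + 1 \<le> card (K y) + m * mu" if y: "y \<in> I" for y
  proof -
    \<comment> \<open>A common neighbour of \<open>x\<close> and \<open>y\<close> is excluded from
      \<open>K y\<close> only if it is adjacent to another member of \<open>I\<close>.\<close>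
    let ?B = "\<Union>z\<in>I - {y}. N y \<inter> N z"
    have "insert y (N x \<inter> N y) \<subseteq> K y \<union> ?B"
      using In[OF y] by (auto simp: K_def)
    then have "card (insert y (N x \<inter> N y)) \<le> card (K y \<union> ?B)"
      using fin by (intro card_mono) (auto simp: K_def)
    also have "\<dots> \<le> card (K y) + card ?B" by (rule card_Un_le)
    also have "card ?B \<le> (\<Sum>z\<in>I - {y}. card (N y \<inter> N z))" using fin by (intro card_UN_le) auto
    also have "\<dots> = card (I - {y}) * mu" using common y by simp
    also have "\<dots> \<le> m * mu" using Im card_Diff1_le[of I y] by (intro mult_right_mono) auto
    also have "card (insert y (N x \<inter> N y)) = lam + 1"
      using card_N_adj[OF x In(1)[OF y] _ In(2)[OF y]] adj_irrefl In[OF y]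
      by (auto simp: card_insert_if)
    finally show ?thesis by simp
  qed
  have rest: "card (N x - \<Union>(K ` I)) \<le> m\<^sup>2 * mu"
  proof -
    \<comment> \<open>By maximality an uncovered vertex has a neighbour in \<open>I\<close>; lying
      outside the corresponding clique, it has a second one.\<close>
    let ?D = "{p \<in> I \<times> I. fst p \<noteq> snd p}"
    have "N x - \<Union>(K ` I) \<subseteq> (\<Union>p\<in>?D. N (fst p) \<inter> N (snd p))"
    proof
      fix z assume "z \<in> N x - \<Union>(K ` I)"
      then have z: "z < n" "E x z" and zK: "\<And>y. y \<in> I \<Longrightarrow> z \<notin> K y" by auto
      have zI: "z \<notin> I" using zK[of z] z by (auto simp: K_def)
      have "\<exists>y\<in>I. E y z"
      proof (rule ccontr)
        assume "\<not> ?thesis"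
        then have "indep x (insert z I)"
          using I z In adj_sym adj_irrefl by (auto simp: indep_def)
        then show False using max[of "insert z I"] zI fin by simp
      qed
      then obtain y where y: "y \<in> I" "E y z" by auto
      then obtain y' where "y' \<in> I" "y' \<noteq> y" "E y' z" using zK[of y] z by (auto simp: K_def)
      with y z show "z \<in> (\<Union>p\<in>?D. N (fst p) \<inter> N (snd p))" by force
    qed
    then have "card (N x - \<Union>(K ` I)) \<le> card (\<Union>p\<in>?D. N (fst p) \<inter> N (snd p))"
      using fin by (intro card_mono) auto
    also have "\<dots> \<le> (\<Sum>p\<in>?D. card (N (fst p) \<inter> N (snd p)))" using fin by (intro card_UN_le) auto
    also have "\<dots> = (\<Sum>p\<in>?D. mu)" by (rule sum.cong) (auto simp: common)
    also have "\<dots> = card ?D * mu" by simp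
    also have "card ?D \<le> card (I \<times> I)" using fin by (intro card_mono) auto
    also have "card (I \<times> I) \<le> m\<^sup>2" using Im by (simp add: card_cartesian_product power2_eq_square mult_mono)
    finally show ?thesis by simp
  qed
  show thesis
  proof (rule that[of "K ` I"])
    show "card (K ` I) \<le> m" using card_image_le[OF fin, of K] Im by simp
    show "finite (K ` I)" using fin by simp
    show "card (N x - \<Union>(K ` I)) \<le> m\<^sup>2 * mu" by (rule rest)
    fix D assume "D \<in> K ` I"
    then obtain y where y: "y \<in> I" "D = K y" by auto
    have "K y \<subseteq> N x" by (auto simp: K_def)
    then show "D \<subseteq> N x \<and> clique D \<and> lam + 1 \<le> card D + m * mu"
      using cl[OF y(1)] sz[OF y(1)] y(2) by simp
  qed
qed

text \<open>Two shared points would be adjacent with all other points of \<open>K\<close> and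
  \<open>D\<close> as common neighbours, so the union would have at most \<open>lam + 2\<close>
  points. The sizes of \<open>K\<close> and \<open>D\<close>, with overlap at most
  \<open>mu\<close>, make it larger.\<close>

lemma cliques_meet_at_most_once:
  assumes xy: "x < n" "y < n" "x \<noteq> y" "\<not> E x y" and lam: "(2 * m + 1) * mu < lam"
    and K: "K \<subseteq> N x" "clique K" "lam + 1 \<le> card K + m * mu"
    and D: "D \<subseteq> N y" "clique D" "lam + 1 \<le> card D + m * mu"
  shows "card (K \<inter> D) \<le> 1"
proof (rule ccontr)
  assume *: "\<not> card (K \<inter> D) \<le> 1"
  have fin: "finite K" "finite D" using K D finite_subset finite_N by blast+
  obtain u v where uv: "u \<in> K \<inter> D" "v \<in> K \<inter> D" "u \<noteq> v"
    using * fin card_le_Suc0_iff_eq[of "K \<inter> D"] by auto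
  have n: "u < n" "v < n" and E: "E u v" using uv K by (auto simp: clique_def)
  have "K \<union> D - {u, v} \<subseteq> N u \<inter> N v"
  proof
    fix z assume z: "z \<in> K \<union> D - {u, v}"
    then have "z < n" using K(1) D(1) by auto
    moreover have "E u z" "E v z"
      using K(2)[unfolded clique_def, rule_format, of u z] K(2)[unfolded clique_def, rule_format, of v z]
        D(2)[unfolded clique_def, rule_format, of u z] D(2)[unfolded clique_def, rule_format, of v z]
        z uv by auto
    ultimately show "z \<in> N u \<inter> N v" by simp
  qed
  then have "card (K \<union> D - {u, v}) \<le> card (N u \<inter> N v)" by (intro card_mono) auto
  also have "\<dots> = lam" using n E uv by (intro card_N_adj) auto
  finally have 1: "card (K \<union> D) \<le> lam + 2"
    using uv fin by (subst (asm) card_Diff_subset) auto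
  have "K \<inter> D \<subseteq> N x \<inter> N y" using K D by auto
  then have "card (K \<inter> D) \<le> card (N x \<inter> N y)" by (intro card_mono) auto
  then have "card (K \<inter> D) \<le> mu" using card_N_nonadj[OF xy] by simp
  moreover have "card K + card D = card (K \<union> D) + card (K \<inter> D)" using fin by (rule card_Un_Int)
  ultimately show False using 1 K(3) D(3) lam by (simp add: algebra_simps)
qed

section \<open>Counting over nonadjacent pairs to bound \<open>mu\<close>\<close>

definition nonadj :: "nat \<Rightarrow> nat set" where
  "nonadj x = {y. y < n \<and> y \<noteq> x \<and> \<not> E x y}"

lemma card_nonadj: "x < n \<Longrightarrow> card (nonadj x) = n - 1 - k"
proof -
  assume x: "x < n"
  have "nonadj x = {..<n} - {x} - N x" by (auto simp: nonadj_def)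
  moreover have "N x \<subseteq> {..<n} - {x}" using adj_irrefl x by auto
  ultimately show ?thesis using x card_N[OF x] by (simp add: card_Diff_subset)
qed

text \<open>Double counting of paths \<open>x, z, y\<close> with \<open>x, y\<close> nonadjacent: all but few \<open>z\<close> lie both
  on a large clique at \<open>x\<close> and on one at \<open>y\<close>, and there are at most \<open>m\<^sup>2\<close> such \<open>z\<close>.\<close>

lemma mu_bound_of_indep_bound:
  assumes n: "0 < n" and m: "\<And>x I. x < n \<Longrightarrow> indep x I \<Longrightarrow> card I \<le> m"
    and lam: "(2 * m + 1) * mu < lam"
  shows "(n - 1 - k) * mu \<le> 2 * m\<^sup>2 * mu * k + (n - 1 - k) * m\<^sup>2"
proof -
  have "\<exists>F. finite F \<and> card F \<le> m \<and> card (N x - \<Union>F) \<le> m\<^sup>2 * mu \<and>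
      (\<forall>K\<in>F. K \<subseteq> N x \<and> clique K \<and> lam + 1 \<le> card K + m * mu)" if "x < n" for x
    using clique_cover[OF that m[OF that]] by metis
  then obtain F where F: "\<And>x. x < n \<Longrightarrow> finite (F x) \<and> card (F x) \<le> m \<and>
      card (N x - \<Union>(F x)) \<le> m\<^sup>2 * mu \<and>
      (\<forall>K\<in>F x. K \<subseteq> N x \<and> clique K \<and> lam + 1 \<le> card K + m * mu)"
    by metis
  \<comment> \<open>The vertices of \<open>N x\<close> missed by the cliques chosen at
    \<open>x\<close>.\<close>
  define B where "B x = N x - \<Union>(F x)" for x
  have fB: "finite (B x)" for x by (simp add: B_def)
  have pair: "mu \<le> card (B x \<inter> N y) + card (B y \<inter> N x) + m\<^sup>2" if x: "x < n" and y: "y \<in> nonadj x" for x y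
  proof -
    have yn: "y < n" "x \<noteq> y" "\<not> E x y" using y by (auto simp: nonadj_def)
    let ?G = "\<Union>p\<in>F x \<times> F y. fst p \<inter> snd p"
    have fF: "finite (F x \<times> F y)" using F x yn by blast
    have "?G \<subseteq> N x"
    proof
      fix z assume "z \<in> ?G"
      then obtain K where "K \<in> F x" "z \<in> K" by auto
      then show "z \<in> N x" using F[OF x] by blast
    qed
    then have fG: "finite ?G" using finite_subset finite_N by blast
    have "N x \<inter> N y \<subseteq> B x \<inter> N y \<union> B y \<inter> N x \<union> ?G"
      by (auto simp: B_def)
    then have "card (N x \<inter> N y) \<le> card (B x \<inter> N y \<union> B y \<inter> N x \<union> ?G)"
      using fB fG by (intro card_mono) auto
    also have "\<dots> \<le> card (B x \<inter> N y) + card (B y \<inter> N x) + card ?G"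
      by (meson add_right_mono card_Un_le le_trans)
    also have "card ?G \<le> (\<Sum>p\<in>F x \<times> F y. card (fst p \<inter> snd p))" using fF by (rule card_UN_le)
    also have "\<dots> \<le> (\<Sum>p\<in>F x \<times> F y. 1)"
    proof (rule sum_mono)
      fix p assume "p \<in> F x \<times> F y"
      then show "card (fst p \<inter> snd p) \<le> 1"
        using F[OF x] F[OF yn(1)] by (intro cliques_meet_at_most_once[OF x yn lam]) auto
    qed
    also have "\<dots> = card (F x) * card (F y)" by (simp add: card_cartesian_product)
    also have "\<dots> \<le> m\<^sup>2" using F[OF x] F[OF yn(1)] by (simp add: power2_eq_square mult_mono)
    also have "card (N x \<inter> N y) = mu" using x yn by (intro card_N_nonadj)
    finally show ?thesis by simp
  qed
  \<comment> \<open>Each of the at most \<open>m\<^sup>2 * mu\<close> vertices in \<open>B x\<close>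
    has only \<open>k\<close> neighbours \<open>y\<close>.\<close>
  have bad: "(\<Sum>y\<in>nonadj x. card (B x \<inter> N y)) \<le> m\<^sup>2 * mu * k" if x: "x < n" for x
  proof -
    have "(\<Sum>y\<in>nonadj x. card (B x \<inter> N y)) \<le> (\<Sum>y<n. card (B x \<inter> N y))"
      by (intro sum_mono2) (auto simp: nonadj_def)
    also have "\<dots> = (\<Sum>y<n. \<Sum>z\<in>B x. of_bool (z \<in> N y))"
      using fB by (simp add: Int_def)
    also have "\<dots> = (\<Sum>z\<in>B x. \<Sum>y<n. of_bool (z \<in> N y))" by (rule sum.swap)
    also have "\<dots> = (\<Sum>z\<in>B x. k)"
    proof (rule sum.cong[OF refl])
      fix z assume "z \<in> B x"
      then have z: "z < n" by (simp add: B_def)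
      have "(\<Sum>y<n. of_bool (z \<in> N y)) = card ({..<n} \<inter> {y. z \<in> N y})" by simp
      also have "{..<n} \<inter> {y. z \<in> N y} = N z" using z adj_sym by auto
      finally show "(\<Sum>y<n. of_bool (z \<in> N y)) = k" using card_N[OF z] by simp
    qed
    also have "\<dots> \<le> m\<^sup>2 * mu * k" using F[OF x] by (simp add: B_def)
    finally show ?thesis .
  qed
  have "(\<Sum>x<n. \<Sum>y\<in>nonadj x. mu)
    \<le> (\<Sum>x<n. \<Sum>y\<in>nonadj x. card (B x \<inter> N y) + card (B y \<inter> N x) + m\<^sup>2)"
    using pair by (intro sum_mono) auto
  also have "\<dots> = (\<Sum>x<n. \<Sum>y\<in>nonadj x. card (B x \<inter> N y))
      + (\<Sum>x<n. \<Sum>y\<in>nonadj x. card (B y \<inter> N x)) + (\<Sum>x<n. \<Sum>y\<in>nonadj x. m\<^sup>2)"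
    by (simp add: sum.distrib)
  \<comment> \<open>Nonadjacency is symmetric, so this sum equals the first one; hence the factor 2
    in the conclusion.\<close>
  also have "(\<Sum>x<n. \<Sum>y\<in>nonadj x. card (B y \<inter> N x)) = (\<Sum>y<n. \<Sum>x\<in>nonadj y. card (B y \<inter> N x))"
  proof -
    have 1: "nonadj x = {y \<in> {..<n}. x \<noteq> y \<and> \<not> E x y}" for x by (auto simp: nonadj_def)
    have 2: "nonadj y = {x \<in> {..<n}. x \<noteq> y \<and> \<not> E x y}" if "y < n" for y
      using that adj_sym by (auto simp: nonadj_def)
    have "(\<Sum>x<n. \<Sum>y\<in>nonadj x. card (B y \<inter> N x))
        = (\<Sum>y<n. \<Sum>x\<in>{x \<in> {..<n}. x \<noteq> y \<and> \<not> E x y}. card (B y \<inter> N x))"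
      unfolding 1 by (rule sum.swap_restrict) auto
    also have "\<dots> = (\<Sum>y<n. \<Sum>x\<in>nonadj y. card (B y \<inter> N x))"
      by (rule sum.cong) (auto simp: 2)
    finally show ?thesis .
  qed
  also have "(\<Sum>x<n. \<Sum>y\<in>nonadj x. card (B x \<inter> N y)) \<le> n * (m\<^sup>2 * mu * k)"
    using sum_mono[of "{..<n}", OF bad] by simp
  finally have "n * ((n - 1 - k) * mu) \<le> n * (2 * m\<^sup>2 * mu * k + (n - 1 - k) * m\<^sup>2)"
    using sum_mono[of "{..<n}", OF bad] by (simp add: card_nonadj algebra_simps)
  then show ?thesis using n by simp
qed

end

section \<open>The eigenvalue bounds\<close>

context srg
begin

lemma mu_le_k:
  assumes "k + 1 < n"
  shows "mu \<le> k"
proof -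
  have "card (nonadj 0) = n - 1 - k" using assms by (intro card_nonadj) simp
  then have "nonadj 0 \<noteq> {}" using assms by auto
  then obtain y where "y \<in> nonadj 0" by blast
  then have "card (N 0 \<inter> N y) = mu" using assms by (intro card_N_nonadj) (auto simp: nonadj_def)
  moreover have "card (N 0 \<inter> N y) \<le> card (N 0)" by (intro card_mono) auto
  ultimately show ?thesis using card_N[of 0] assms by simp
qed

text \<open>If \<open>s\<close> is between -1 and 0, both branches of the claw bound are
  nonpositive. If \<open>s\<close> is positive, the conjugate root is an eigenvalue and hence
  positive too, while the product of the roots is \<open>mu - k\<close>, which is at most 0.\<close>

lemma smallest_eigenvalue_less:
  fixes r s :: real
  assumes kn: "k + 1 < n" and s: "eigenvalue (adj_matrix n E) s"
    and only: "\<And>x. eigenvalue (adj_matrix n E) x \<Longrightarrow> x = real k \<or> x = r \<or> x = s"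
    and r: "0 < r" "r \<le> k" "s < r"
    and claw: "r \<le> max (2 * (- s - 1) * (real mu + 1 + s) + s) (s * (s + 1) * (real mu + 1) / 2 - 1)"
  shows "s < -1"
proof (rule ccontr)
  assume "\<not> s < -1"
  then consider "-1 \<le> s" "s \<le> 0" | "0 < s" by linarith
  then show False
  proof cases
    case 1
    have "2 * (- s - 1) * (real mu + 1 + s) \<le> 0" using 1 by (intro mult_nonpos_nonneg[of "2 * (- s - 1)"]) auto
    moreover have "s * (s + 1) \<le> 0" using 1 by (intro mult_nonpos_nonneg) auto
    then have "s * (s + 1) * (real mu + 1) \<le> 0" by (rule mult_nonpos_nonneg) simp
    ultimately show False using claw r 1 by linarith
  next
    case 2
    have q: "s\<^sup>2 = (real k - mu) + (real lam - mu) * s"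
      using s r by (intro restricted_eigenvalue_quadratic) auto
    then have "eigenvalue (adj_matrix n E) (real lam - mu - s)"
      using 2 kn by (intro conjugate_eigenvalue) auto
    then have "0 < real lam - mu - s" using only r 2 by force
    then have "0 < (real lam - mu - s) * s" using 2 by simp
    moreover have "(real lam - mu - s) * s = real mu - k"
      using q by (simp add: algebra_simps power2_eq_square)
    ultimately show False using mu_le_k[OF kn] by simp
  qed
qed

text \<open>The conjugate of \<open>s\<close> is an eigenvalue, so it is \<open>k\<close>,
  \<open>s\<close> or \<open>r\<close>; the product \<open>mu - k\<close> of the roots rules out the
  first two.\<close>

lemma restricted_eigenvalues_sum_prod:
  fixes r s :: real
  assumes kn: "k + 1 < n" and s: "eigenvalue (adj_matrix n E) s"
    and only: "\<And>x. eigenvalue (adj_matrix n E) x \<Longrightarrow> x = real k \<or> x = r \<or> x = s"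
    and r: "0 < r" "r \<le> k" and s1: "s < -1"
  shows "r + s = real lam - mu" "r * s = real mu - k"
proof -
  have q: "s\<^sup>2 = (real k - mu) + (real lam - mu) * s"
    using s r s1 by (intro restricted_eigenvalue_quadratic) auto
  define s' where "s' = real lam - mu - s"
  have prod: "s' * s = real mu - k"
    using q by (simp add: s'_def algebra_simps power2_eq_square)
  have "eigenvalue (adj_matrix n E) s'"
    unfolding s'_def using q s1 kn by (intro conjugate_eigenvalue) auto
  then consider "s' = k" | "s' = s" | "s' = r" using only by blast
  then have "s' = r"
  proof cases
    case 1
    then have "k * (s + 1) = mu" using prod by (simp add: algebra_simps)
    moreover have "k * (s + 1) < 0" using r s1 by (intro mult_pos_neg) auto
    ultimately show ?thesis by simp
  next
    case 2
    then have "s * s \<le> 0" using prod mu_le_k[OF kn] by simp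
    then show ?thesis using s1 by (simp add: mult_le_0_iff)
  qed
  then show "r + s = real lam - mu" "r * s = real mu - k" using prod by (auto simp: s'_def)
qed

end

section \<open>Three bounds on \<open>r\<close> in terms of \<open>n\<close> and
  \<open>k\<close>\<close>

locale srg_claw = srg +
  fixes r t :: real
  assumes k_half: "real k \<le> (real n - 1) / 2"
    and r_pos: "0 < r" and r_le: "r \<le> k" and t: "1 < t"
    and diff: "r - t = real lam - mu" and prod: "r * t = real k - mu"
    and claw: "r \<le> max (2 * (t - 1) * (real mu + 1 - t) - t) (t * (t - 1) * (real mu + 1) / 2 - 1)"
begin

lemma n_pos: "0 < n" and k_pos: "0 < k"
  using k_half r_pos r_le by (auto intro!: Nat.gr0I)

text \<open>The right-hand side is the quadratic with roots \<open>r\<close> and \<open>- t\<close>,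
  evaluated at \<open>k\<close>; \<open>k_square\<close> identifies this value.\<close>

lemma n_mu: "real n * mu = (k - r) * (k + t)"
proof -
  have "(k - r) * (k + t) = real k ^ 2 - k * (r - t) - r * t"
    by (simp add: algebra_simps power2_eq_square)
  then show ?thesis unfolding diff prod k_square[OF n_pos] by (simp add: algebra_simps)
qed

text \<open>If \<open>mu\<close> were 0, \<open>n_mu\<close> would force \<open>r = k\<close>, and
  then \<open>prod\<close> would give \<open>t = 1\<close>.\<close>

lemma mu_pos: "1 \<le> real mu"
proof (rule ccontr)
  assume "\<not> 1 \<le> real mu"
  then have mu: "mu = 0" by simp
  then have "(k - r) * (k + t) = 0" using n_mu by simp
  moreover have "k + t > 0" using t by simp
  ultimately have "r = k" by simp
  then have "r * t = r * 1" using prod mu by simp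
  then show False using r_pos t by simp
qed

lemma rt_le: "r * t \<le> k"
  using prod by simp

lemma n_mu_le: "real n * mu \<le> 3 * real k ^ 2"
proof -
  have "mu \<le> real k" using prod r_pos t mult_pos_pos[of r t] by linarith
  then have "k + t \<le> 3 * k" using diff r_le by linarith
  then have "(k - r) * (k + t) \<le> k * (3 * real k)"
    using r_pos r_le t by (intro mult_mono) auto
  then show ?thesis using n_mu by (simp add: power2_eq_square)
qed

text \<open>Since \<open>mu\<close> is at least 1, \<open>mu + 1\<close> is at most
  \<open>2 * mu\<close> in both branches of the claw bound.\<close>

lemma r_le_t_square_mu: "r \<le> 4 * t\<^sup>2 * mu"
proof -
  have 1: "(t - 1) * (real mu + 1 - t) \<le> t * t * (2 * mu)"
  proof -
    have "(t - 1) * (real mu + 1 - t) \<le> (t - 1) * (2 * mu)"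
      using t mu_pos by (intro mult_left_mono) auto
    also have "\<dots> \<le> t * t * (2 * mu)"
    proof (rule mult_right_mono)
      have "t * 1 \<le> t * t" using t by (intro mult_left_mono) auto
      then show "t - 1 \<le> t * t" by simp
    qed simp
    finally show ?thesis .
  qed
  have 2: "t * (t - 1) * (real mu + 1) \<le> t * t * (2 * mu)"
    using t mu_pos by (intro mult_mono) auto
  have "0 \<le> t * t * (2 * mu)" by simp
  then have "2 * (t - 1) * (real mu + 1 - t) - t \<le> 2 * (t * t * (2 * mu))"
    "t * (t - 1) * (real mu + 1) / 2 - 1 \<le> 2 * (t * t * (2 * mu))"
    using 1 2 t unfolding mult.assoc by linarith+
  then have "r \<le> 2 * (t * t * (2 * mu))" using claw by linarith
  then show ?thesis by (simp add: power2_eq_square)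
qed

lemma r_cube_bound: "real n * r ^ 3 \<le> 12 * real k ^ 4"
proof -
  have "r ^ 3 = r * r\<^sup>2" by (simp add: power3_eq_cube power2_eq_square)
  also have "\<dots> \<le> (4 * t\<^sup>2 * mu) * r\<^sup>2" using r_le_t_square_mu by (intro mult_right_mono) auto
  also have "\<dots> = 4 * mu * (r * t)\<^sup>2" by (simp add: power_mult_distrib)
  also have "\<dots> \<le> 4 * mu * (real k)\<^sup>2"
    using rt_le r_pos t by (intro mult_left_mono power_mono) auto
  finally have "n * r ^ 3 \<le> n * (4 * mu * (real k)\<^sup>2)" by (intro mult_left_mono) auto
  also have "\<dots> = (real n * mu) * (4 * (real k)\<^sup>2)" by simp
  also have "\<dots> \<le> (3 * (real k)\<^sup>2) * (4 * (real k)\<^sup>2)"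
    using n_mu_le by (intro mult_right_mono) auto
  also have "\<dots> = 12 * real k ^ 4" by (simp add: power_numeral_reduce)
  finally show ?thesis .
qed

lemma r_fourth_bound: "r ^ 4 \<le> real n * real k ^ 2"
proof -
  have "r\<^sup>2 \<le> n * (- t)\<^sup>2"
    using diff prod r_pos r_le t k_half by (intro r_square_le) auto
  then have "r\<^sup>2 * r\<^sup>2 \<le> (n * t\<^sup>2) * r\<^sup>2" by (intro mult_right_mono) auto
  also have "\<dots> = n * (r * t)\<^sup>2" by (simp add: power_mult_distrib)
  also have "\<dots> \<le> n * (real k)\<^sup>2"
    using rt_le r_pos t by (intro mult_left_mono power_mono) auto
  finally show ?thesis by (simp add: power_numeral_reduce)
qed

lemma r_square_bound: "real n * r\<^sup>2 \<le> 2500 * real k ^ 3 \<or> r\<^sup>2 \<le> 24 * real n"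
proof (cases "real n * r\<^sup>2 \<le> 2500 * real k ^ 3")
  case False
  then have big: "2500 * real k ^ 3 < n * r\<^sup>2" by simp
  have kp: "0 < real k" using k_pos by simp
  have "(2500 * k * t\<^sup>2) * (real k)\<^sup>2 = (2500 * real k ^ 3) * t\<^sup>2"
    by (simp add: power_numeral_reduce)
  also have "\<dots> < (n * r\<^sup>2) * t\<^sup>2" using big t by (intro mult_strict_right_mono) auto
  also have "\<dots> = n * (r * t)\<^sup>2" by (simp add: power_mult_distrib)
  also have "\<dots> \<le> n * (real k)\<^sup>2"
    using rt_le r_pos t by (intro mult_left_mono power_mono) auto
  finally have n_large: "2500 * k * t\<^sup>2 < n" using kp by simp
  have "k * (2500 * t\<^sup>2 * mu) = 2500 * k * t\<^sup>2 * mu" by simp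
  also have "\<dots> \<le> real n * mu" using n_large by (intro mult_right_mono) auto
  also have "\<dots> \<le> k * (3 * real k)" using n_mu_le by (simp add: power2_eq_square)
  finally have t2mu: "2500 * (t\<^sup>2 * mu) \<le> 3 * k" using kp by simp
  have "1 \<le> t\<^sup>2" using t by simp
  then have "1 * real mu \<le> t\<^sup>2 * mu" by (intro mult_right_mono) auto
  then have mu_le: "mu \<le> t\<^sup>2 * mu" by simp
  have r_half: "r \<le> k / 2" using r_le_t_square_mu t2mu kp by simp
  \<comment> \<open>\<open>k\<close> is \<open>r * t + mu\<close> and \<open>mu\<close> is a tiny
    fraction of \<open>k\<close>. The slack 4/3 turns \<open>3 * k\<close> into
    \<open>4 * (r * t)\<close>, whence 625 = 2500 / 4.\<close>
  have "k \<le> 4 / 3 * (r * t)" using prod mu_le t2mu by linarith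
  then have "t * (625 * (t * mu)) \<le> t * r"
    using t2mu by (simp add: power2_eq_square mult_ac)
  then have tmu: "625 * (t * mu) \<le> r" using t by simp
  have "t * 1 \<le> t * mu" using t mu_pos by (intro mult_left_mono) auto
  then have lam_ge: "624 * r \<le> 625 * real lam" using tmu diff by simp
  \<comment> \<open>An independent set of size about \<open>2 * t\<close> would need about
    \<open>2 * r * t\<close> neighbours of \<open>x\<close>, twice the approximate value
    \<open>r * t\<close> of \<open>k\<close>. Rounding up stays below \<open>3 * t\<close> since
    \<open>t > 1\<close>.\<close>
  define j where "j = nat \<lceil>2 * t\<rceil>"
  have j: "2 * t \<le> j" "j \<le> 3 * t" unfolding j_def using t by linarith+
  have "(real j)\<^sup>2 \<le> (3 * t)\<^sup>2" using j by (intro power_mono) auto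
  then have j2: "(real j)\<^sup>2 \<le> 9 * t\<^sup>2" by (simp add: power_mult_distrib)
  have indep: "card I \<le> j" if x: "x < n" and I: "indep x I" for x I
  proof (rule ccontr)
    assume "\<not> card I \<le> j"
    \<comment> \<open>Size exactly \<open>j\<close> is needed, because the overlap term of
      \<open>indep_card_bound\<close> is quadratic in the size.\<close>
    then obtain J where J: "J \<subseteq> I" "card J = j" by (metis nat_le_linear obtain_subset_with_card_n)
    then have "indep x J" using I unfolding indep_def by blast
    then have "j * (lam + 1) \<le> k + j\<^sup>2 * mu" using indep_card_bound[OF x] J by metis
    then have "real (j * (lam + 1)) \<le> real (k + j\<^sup>2 * mu)" by (simp only: of_nat_le_iff)
    then have 1: "real j * (real lam + 1) \<le> k + (real j)\<^sup>2 * mu" by (simp add: algebra_simps)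
    have "(2 * t) * (624 / 625 * r) \<le> real j * (real lam + 1)"
      using j lam_ge r_pos t by (intro mult_mono) auto
    also note 1
    also have "k + (real j)\<^sup>2 * mu \<le> r * t + mu + 9 * t\<^sup>2 * mu"
      using prod mult_right_mono[OF j2, of mu] by simp
    also have "\<dots> \<le> r * t + 10 * (t\<^sup>2 * mu)" using mu_le by (simp add: mult.commute)
    also have "t\<^sup>2 * mu = (t * mu) * t" by (simp add: power2_eq_square)
    also have "r * t + 10 * ((t * mu) * t) \<le> r * t + 10 * ((r / 625) * t)"
      using tmu t by (intro add_left_mono mult_left_mono mult_right_mono) auto
    finally have "r * t \<le> 0" by simp
    then show False using r_pos t by (simp add: mult_le_0_iff)
  qed
  have "real ((2 * j + 1) * mu) \<le> 7 * t * mu"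
    using j t mult_right_mono[of "2 * j + 1" "7 * t" "real mu"] by (simp add: algebra_simps)
  also have "\<dots> < lam" using tmu lam_ge r_pos by simp
  finally have "(2 * j + 1) * mu < lam" by (simp only: of_nat_less_iff)
  then have "(n - 1 - k) * mu \<le> 2 * j\<^sup>2 * mu * k + (n - 1 - k) * j\<^sup>2"
    using n_pos indep by (intro mu_bound_of_indep_bound) auto
  then have "real ((n - 1 - k) * mu) \<le> real (2 * j\<^sup>2 * mu * k + (n - 1 - k) * j\<^sup>2)"
    by (simp only: of_nat_le_iff)
  moreover define w where "w = real (n - 1 - k)"
  ultimately have "w * mu \<le> 2 * mu * k * (real j)\<^sup>2 + w * (real j)\<^sup>2"
    by (simp add: mult_ac)
  also have "\<dots> \<le> 2 * mu * k * (9 * t\<^sup>2) + w * (9 * t\<^sup>2)"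
    using j2 by (intro add_mono mult_left_mono) (auto simp: w_def)
  also have "2 * mu * k * (9 * t\<^sup>2) = 18 / 2500 * mu * (2500 * k * t\<^sup>2)" by simp
  also have "\<dots> \<le> 18 / 2500 * mu * n"
    using n_large by (intro mult_left_mono) auto
  finally have 1: "w * mu \<le> 18 / 2500 * mu * n + w * (9 * t\<^sup>2)" by simp
  have "real (2 * k + 1) \<le> real n" using k_half by simp
  then have "2 * k + 1 \<le> n" by (simp only: of_nat_le_iff)
  then have w: "n \<le> 4 * w" "0 < w" using k_pos by (auto simp: w_def)
  \<comment> \<open>This makes the \<open>mu * n\<close> term at most 72/2500 of
    \<open>w * mu\<close>, so it is absorbed on the left and 9 grows to less than 12.\<close>
  have "mu * real n \<le> mu * (4 * w)" using w by (intro mult_left_mono) auto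
  moreover have "0 \<le> w * t\<^sup>2" using w by simp
  ultimately have "w * mu \<le> w * (12 * t\<^sup>2)" using 1 by (simp add: mult_ac)
  then have mu12: "mu \<le> 12 * t\<^sup>2" using w by simp
  \<comment> \<open>By \<open>n_mu\<close> the right-hand side is \<open>n * mu\<close>, so the
    bound on \<open>mu\<close> bounds \<open>k\<close> in terms of \<open>n\<close> and
    \<open>t\<close>.\<close>
  have "(k / 2) * k \<le> (k - r) * (k + t)" using r_half t by (intro mult_mono) auto
  also have "\<dots> \<le> n * (12 * t\<^sup>2)" unfolding n_mu[symmetric] using mu12 by (intro mult_left_mono) auto
  finally have "(real k)\<^sup>2 \<le> t\<^sup>2 * (24 * n)" by (simp add: power2_eq_square mult_ac)
  moreover have "(r * t)\<^sup>2 \<le> (real k)\<^sup>2" using rt_le r_pos t by (intro power_mono) auto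
  ultimately have "t\<^sup>2 * r\<^sup>2 \<le> t\<^sup>2 * (24 * n)" by (simp add: power_mult_distrib mult_ac)
  then show ?thesis using t by simp
qed simp

text \<open>Each term of the minimum is compared after raising to the power that clears its
  fractional exponents. The constant 50 is the square root of the 2500 in
  \<open>r_square_bound\<close>; the other comparisons have room to spare.\<close>

lemma r_over_n_le: "r / n \<le> 50 * g_fun n k"
proof -
  have n: "0 < real n" and k: "0 < real k" using n_pos k_pos by auto
  have pw: "(x powr a) ^ m = x ^ l" if "0 < x" "a * real m = real l" for x a :: real and m l
    using that by (simp add: powr_powr flip: powr_realpow)
  have "r / n \<le> 50 * (real k / n) powr (4/3)"
  \<comment> \<open>This rule compares powers with exponent \<open>Suc n\<close>, so
    \<open>n = 2\<close> means cubes.\<close>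
  proof (rule power_le_imp_le_base[where n = 2])
    have "r ^ 3 \<le> 12 * real k ^ 4 / n" using r_cube_bound n by (simp add: field_simps)
    then have "(r / n) ^ 3 \<le> 12 * (real k / n) ^ 4"
      using n by (simp add: power_divide field_simps power_numeral_reduce)
    also have "\<dots> \<le> 50 ^ 3 * (real k / n) ^ 4" by (intro mult_right_mono) auto
    also have "\<dots> = (50 * (real k / n) powr (4/3)) ^ 3"
      unfolding power_mult_distrib using n k by (subst pw[where l = 4]) auto
    finally show "(r / n) ^ Suc 2 \<le> (50 * (real k / n) powr (4/3)) ^ Suc 2" by (simp add: numeral_3_eq_3)
  qed simp
  moreover have "r / n \<le> 50 * (real k powr (1/2) / real n powr (3/4))"
  proof (rule power_le_imp_le_base[where n = 3])
    have "(r / n) ^ 4 \<le> real k ^ 2 / real n ^ 3"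
      using r_fourth_bound n by (simp add: power_divide field_simps power_numeral_reduce)
    also have "\<dots> \<le> 50 ^ 4 * (real k ^ 2 / real n ^ 3)"
      using mult_right_mono[of 1 "50 ^ 4" "real k ^ 2 / real n ^ 3"] by simp
    also have "\<dots> = (50 * (real k powr (1/2) / real n powr (3/4))) ^ 4"
      unfolding power_mult_distrib power_divide using n k
      by (subst pw[where l = 2], simp, simp, subst pw[where l = 3]) auto
    finally show "(r / n) ^ Suc 3 \<le> (50 * (real k powr (1/2) / real n powr (3/4))) ^ Suc 3" by simp
  qed simp
  moreover have "r / n \<le> 50 * max ((real k / n) powr (3/2)) ((1 / n) powr (1/2))"
  proof -
    have "r / n \<le> 50 * (real k / n) powr (3/2) \<or> r / n \<le> 50 * (1 / n) powr (1/2)"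
      using r_square_bound
    proof
      assume "real n * r\<^sup>2 \<le> 2500 * real k ^ 3"
      then have "(r / n)\<^sup>2 \<le> 50\<^sup>2 * (real k / n) ^ 3"
        using n by (simp add: power_divide field_simps power_numeral_reduce)
      also have "\<dots> = (50 * (real k / n) powr (3/2))\<^sup>2"
        unfolding power_mult_distrib using n k by (subst pw[where l = 3]) auto
      finally show ?thesis by (intro disjI1) (rule power2_le_imp_le, auto)
    next
      assume "r\<^sup>2 \<le> 24 * real n"
      then have "(r / n)\<^sup>2 \<le> 50\<^sup>2 * (1 / n) ^ 1"
        using n by (simp add: power_divide field_simps power_numeral_reduce)
      also have "\<dots> = (50 * (1 / n) powr (1/2))\<^sup>2"
        unfolding power_mult_distrib using n by (subst pw[where l = 1]) auto
      finally show ?thesis by (intro disjI2) (rule power2_le_imp_le, auto)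
    qed
    then show ?thesis by (auto simp: max_def)
  qed
  ultimately show ?thesis by (auto simp: g_fun_def min_def)
qed

end

theorem theorem19:
  shows "\<exists>C::real. C > 0 \<and>
    (\<forall>(n::nat) (E::nat \<Rightarrow> nat \<Rightarrow> bool) (k::nat) (lam::nat) (mu::nat) (r::real) (s::real).
       strongly_regular n E k lam mu \<longrightarrow>
       real k \<le> (real n - 1) / 2 \<longrightarrow>
       eigenvalue (adj_matrix n E) r \<longrightarrow>
       eigenvalue (adj_matrix n E) s \<longrightarrow>
       (\<forall>x. eigenvalue (adj_matrix n E) x \<longrightarrow> x = real k \<or> x = r \<or> x = s) \<longrightarrow>
       real k \<ge> r \<longrightarrow> r > s \<longrightarrow>
       r \<le> max (2 * (- s - 1) * (real mu + 1 + s) + s) (s * (s + 1) * (real mu + 1) / 2 - 1) \<longrightarrow>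
       r / real n \<le> C * g_fun n k)"
proof (intro exI[of _ 50] conjI allI impI)
  fix n :: nat and E :: "nat \<Rightarrow> nat \<Rightarrow> bool" and k lam mu :: nat and r s :: real
  assume srg: "strongly_regular n E k lam mu" and k: "real k \<le> (real n - 1) / 2"
    and s: "eigenvalue (adj_matrix n E) s"
    and only: "\<forall>x. eigenvalue (adj_matrix n E) x \<longrightarrow> x = real k \<or> x = r \<or> x = s"
    and r: "r \<le> real k" "s < r"
    and claw: "r \<le> max (2 * (- s - 1) * (real mu + 1 + s) + s) (s * (s + 1) * (real mu + 1) / 2 - 1)"
  interpret srg n E k lam mu by unfold_locales (rule srg)
  show "r / real n \<le> 50 * g_fun n k"
  \<comment> \<open>For \<open>r\<close> at most 0 the claim is trivial because \<open>g_fun\<close>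
    is nonnegative; the rest of the argument needs \<open>r > 0\<close>.\<close>
  proof (cases "0 < r")
    case False
    then have "r / n \<le> 0" by (simp add: divide_nonpos_nonneg)
    also have "0 \<le> 50 * g_fun n k" by (simp add: g_fun_def le_max_iff_disj)
    finally show ?thesis .
  next
    case True
    have "0 < k" using r True by (intro Nat.gr0I) auto
    moreover have "real (2 * k + 1) \<le> real n" using k by simp
    then have "2 * k + 1 \<le> n" by (simp only: of_nat_le_iff)
    ultimately have kn: "k + 1 < n" by simp
    have s1: "s < -1" using kn s only True r claw by (intro smallest_eigenvalue_less[of s r]) auto
    have sp: "r + s = real lam - mu" "r * s = real mu - k"
      using restricted_eigenvalues_sum_prod[OF kn s _ True r(1) s1] only by auto
    interpret srg_claw n E k lam mu r "- s"
      using k True r s1 sp claw by unfold_locales (auto simp: algebra_simps)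
    show ?thesis by (rule r_over_n_le)
  qed
qed simp

end
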